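(* Let $m$ and $M$ be two positive integers. Then $$\mathsf{D}(\llbracket -m,M \rrbracket ) = m+M -\rho (m,M).$$
   Context: A finite sequence of integers $S=s_1\cdots s_n$ is an unordered finite multiset of integers; $n=|S|$ is its length. $S$ is a zero-sum sequence if $\sum_{i=1}^n s_i=0$, and a minimal zero-sum sequence if moreover $\sum_{i\in I}s_i\neq 0$ for every non-empty proper subset $I\subsetneq\{1,\dots,n\}$. For integers $a\le b$, $\llbracket a,b\rrbracket$ denotes the set of integers $i$ with $a\le i\le b$. For positive integers $m,M$, $\mathsf{D}(\llbracket -m,M\rrbracket)$ is the maximal length of a minimal zero-sum sequence all of whose elements lie in $\llbracket -m,M\rrbracket$. Define $$\rho(m,M)=\min\{t\in\mathbb{Z}_{\ge 0} : \text{there is } t'\in\mathbb{Z}_{\ge0},\ 0\le t'\le t,\ \gcd(M-t',\,m-(t-t'))=1\}.$$ *)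

theory Defs
  imports Main "HOL-Library.Multiset"
begin

definition zero_sum :: "int multiset \<Rightarrow> bool" where
  "zero_sum S \<longleftrightarrow> sum_mset S = 0"

text \<open>The subsequences indexed by non-empty proper index sets are exactly the non-empty
  proper submultisets.\<close>

definition minimal_zero_sum :: "int multiset \<Rightarrow> bool" where
  "minimal_zero_sum S \<longleftrightarrow>
     zero_sum S \<and> (\<forall>T. T \<noteq> {#} \<and> T \<subset># S \<longrightarrow> sum_mset T \<noteq> 0)"

definition minimal_zero_sum_lengths :: "int set \<Rightarrow> nat set" where
  "minimal_zero_sum_lengths A = {size S | S. minimal_zero_sum S \<and> set_mset S \<subseteq> A}"

text \<open>\<open>Max\<close> is meaningful only on finite non-empty sets; for an integer interval
  \<open>{-m..M}\<close> this is guaranteed by \<open>finite_minimal_zero_sum_lengths\<close> and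
  \<open>minimal_zero_sum_lengths_nonempty\<close> below.\<close>

definition davenport :: "int set \<Rightarrow> nat" where
  "davenport A = Max (minimal_zero_sum_lengths A)"

text \<open>The subtractions are integer subtractions, so an argument of \<open>gcd\<close> may be zero or
  negative; \<open>gcd\<close> is the non-negative one, with \<open>gcd 0 0 = 0\<close>.\<close>

definition rho :: "int \<Rightarrow> int \<Rightarrow> nat" where
  "rho m M = (LEAST t::nat. \<exists>t'::nat. t' \<le> t \<and> gcd (M - int t') (m - (int t - int t')) = 1)"

lemma minimal_zero_sum_lengths_nonempty: "minimal_zero_sum_lengths A \<noteq> {}"
proof -
  have "minimal_zero_sum {#}" by (simp add: minimal_zero_sum_def zero_sum_def)
  then show ?thesis unfolding minimal_zero_sum_lengths_def by force
qed

lemma rho_set_nonempty: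
  assumes "M > 0"
  shows "\<exists>t t'::nat. t' \<le> t \<and> gcd (M - int t') (m - (int t - int t')) = 1"
  using assms by (intro exI[of _ "nat (M - 1)"]) auto

text \<open>A zero-sum sequence can be arranged so that all partial sums stay in the interval.\<close>

lemma exists_balanced_arrangement:
  fixes m M :: int
  assumes "m \<ge> 0" "M \<ge> 0" "sum_mset S = 0" "set_mset S \<subseteq> {-m..M}" "k \<le> size S"
  shows "\<exists>xs. length xs = k \<and> mset xs \<subseteq># S \<and> (\<forall>i\<le>k. sum_list (take i xs) \<in> {-m..M})"
  using assms(5)
proof (induction k)
  case 0
  then show ?case using assms by auto
next
  case (Suc k)
  then obtain xs where xs: "length xs = k" "mset xs \<subseteq># S"
      "\<forall>i\<le>k. sum_list (take i xs) \<in> {-m..M}" by auto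
  define R where "R = S - mset xs"
  have S: "S = mset xs + R" using xs(2) by (simp add: R_def)
  have "size R \<noteq> 0" using Suc.prems S xs(1) by (metis Suc_n_not_le_n add.right_neutral size_mset size_union)
  then have "R \<noteq> {#}" by auto
  have sumR: "sum_mset R = - sum_list xs" using assms(3) S by (simp add: sum_mset_sum_list)
  have bound: "sum_list xs \<in> {-m..M}" using xs(1,3) by auto
  have neg: "sum_mset T < 0" if "T \<noteq> {#}" "\<forall>x\<in>#T. x < 0" for T :: "int multiset"
    using that by (induction T) (auto, metis add_neg_neg add.right_neutral sum_mset.empty)
  have pos: "sum_mset T > 0" if "T \<noteq> {#}" "\<forall>x\<in>#T. x > 0" for T :: "int multiset"
    using that by (induction T) (auto, metis add_pos_pos add.right_neutral sum_mset.empty)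
  have "\<exists>x\<in>#R. sum_list xs + x \<in> {-m..M}"
  proof (cases "sum_list xs \<le> 0")
    case True
    then obtain x where "x \<in># R" "x \<ge> 0" using neg[OF \<open>R \<noteq> {#}\<close>] sumR by force
    moreover have "x \<le> M" using \<open>x \<in># R\<close> S assms(4) by auto
    ultimately show ?thesis using bound True by force
  next
    case False
    then obtain x where "x \<in># R" "x \<le> 0" using pos[OF \<open>R \<noteq> {#}\<close>] sumR by force
    moreover have "x \<ge> -m" using \<open>x \<in># R\<close> S assms(4) by auto
    ultimately show ?thesis using bound False by force
  qed
  then obtain x where x: "x \<in># R" "sum_list xs + x \<in> {-m..M}" by blast
  have "mset (xs @ [x]) \<subseteq># S" using x(1) S by simp
  moreover have "sum_list (take i (xs @ [x])) \<in> {-m..M}" if "i \<le> Suc k" for i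
    using that xs(1,3) x(2) by (cases "i = Suc k") auto
  ultimately show ?case using xs(1) by (intro exI[of _ "xs @ [x]"]) auto
qed

lemma minimal_zero_sum_size_le:
  fixes m M :: int
  assumes "m \<ge> 0" "M \<ge> 0" "minimal_zero_sum S" "set_mset S \<subseteq> {-m..M}"
  shows "size S \<le> nat (m + M + 1)"
proof (rule ccontr)
  assume less: "\<not> size S \<le> nat (m + M + 1)"
  obtain xs where xs: "length xs = size S" "mset xs \<subseteq># S"
      "\<forall>i\<le>size S. sum_list (take i xs) \<in> {-m..M}"
    using exists_balanced_arrangement[of m M S "size S"] assms
    by (auto simp: minimal_zero_sum_def zero_sum_def)
  have S: "S = mset xs" using xs(1,2)
    by (metis mset_subset_size size_mset subset_mset.less_le nat_neq_iff)
  let ?f = "\<lambda>i. sum_list (take i xs)"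
  have "?f ` {..<size S} \<subseteq> {-m..M}" using xs(3) by auto
  then have "card (?f ` {..<size S}) \<le> card {-m..M}" by (intro card_mono) auto
  then have "card (?f ` {..<size S}) < card {..<size S}" using less by simp
  then have "\<not> inj_on ?f {..<size S}" using pigeonhole by blast
  then obtain i j where ij: "i < j" "j < size S" "?f i = ?f j"
    unfolding inj_on_def by (metis lessThan_iff nat_neq_iff)
  define T where "T = drop i (take j xs)"
  have "take j xs = take i xs @ T" using ij
    by (simp add: T_def) (metis append_take_drop_id min.absorb1 less_imp_le take_take)
  then have sumT: "sum_list T = 0" using ij(3) by simp
  have "xs = take i xs @ T @ drop j xs"
    using \<open>take j xs = take i xs @ T\<close> by (metis append.assoc append_take_drop_id)
  then have "mset xs = mset (take i xs) + mset T + mset (drop j xs)"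
    by (metis mset_append add.assoc)
  then have sub: "mset T \<subseteq># S" unfolding S
    by (metis add.assoc add.commute mset_subset_eq_add_left)
  have len: "length T = j - i" using ij xs(1) by (simp add: T_def)
  have "mset T \<noteq> S" using len ij xs(1) by (metis diff_le_self leD size_mset)
  with sub have "mset T \<subset># S" by (simp add: subset_mset.less_le)
  moreover have "mset T \<noteq> {#}" using len ij by auto
  ultimately have "sum_mset (mset T) \<noteq> 0" using assms(3)
    unfolding minimal_zero_sum_def by blast
  then show False using sumT by (simp add: sum_mset_sum_list)
qed

lemma finite_minimal_zero_sum_lengths:
  fixes m M :: int
  assumes "m \<ge> 0" "M \<ge> 0"
  shows "finite (minimal_zero_sum_lengths {-m..M})"
  by (rule finite_subset[of _ "{..nat (m + M + 1)}"])
    (use minimal_zero_sum_size_le[OF assms] in \<open>auto simp: minimal_zero_sum_lengths_def\<close>)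

end

theory Submission imports Defs begin

text \<open>Let \<open>S\<close> be a minimal zero-sum sequence over \<open>{-m..M}\<close> with \<open>k\<close> positive and \<open>l\<close> negative terms.
  The upper bound amounts to finding coprime \<open>x\<close>, \<open>y\<close> with \<open>l \<le> x \<le> M\<close> and \<open>k \<le> y \<le> m\<close>, which is done
  by a Euclidean descent. Say \<open>m < M\<close>. If \<open>l \<le> m + 1\<close>, take \<open>(m + 1, m)\<close>. Otherwise replace some pairs
  \<open>p\<close>, \<open>-n\<close> of terms by their sums \<open>p - n\<close> (which preserves minimality) so that the new sequence lives
  in \<open>{-m'..M - m'}\<close> with \<open>m' \<le> m\<close>; a coprime pair \<open>(x, y)\<close> for it gives \<open>(x + y, y)\<close> for \<open>S\<close>.
  A merged pair may become negative, which would lose a positive term; therefore the bounds on \<open>x\<close> and \<open>y\<close>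
  are strengthened to count also the terms of the other sign which are small compared with the
  difference of the endpoints.\<close>

section \<open>Counting negative and small positive terms\<close>

text \<open>For a sequence without zeros, \<open>low d S\<close> counts the negative terms and the positive terms up to \<open>d\<close>;
  the latter contribute only if \<open>d > 0\<close>.\<close>

definition low :: "int \<Rightarrow> int multiset \<Rightarrow> nat" where
  "low d S = size {#e \<in># S. e < 0 \<or> e \<le> d#}"

lemma low_union: "low d (A + B) = low d A + low d B"
  by (simp add: low_def)

lemma low_le_size: "low d A \<le> size A"
  by (simp add: low_def size_filter_mset_lesseq)

lemma low_eq_size: "(\<And>e. e \<in># A \<Longrightarrow> e < 0 \<or> e \<le> d) \<Longrightarrow> low d A = size A"
  by (induction A) (auto simp: low_def)

lemma low_eq_0: "(\<And>e. e \<in># A \<Longrightarrow> e \<ge> 0 \<and> e > d) \<Longrightarrow> low d A = 0"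
  by (induction A) (force simp: low_def)+

lemma low_mono: "d \<le> d' \<Longrightarrow> low d A \<le> low d' A"
  by (induction A) (auto simp: low_def)

lemma size_eq_low_plus_low:
  assumes "0 \<notin># S"
  shows "size S = low 0 S + low 0 (image_mset uminus S)"
  using assms by (induction S) (auto simp: low_def)

section \<open>Negation, merging and partial sums of minimal zero-sum sequences\<close>

lemma minimal_zero_sumD:
  assumes "minimal_zero_sum S" "T \<subseteq># S" "T \<noteq> {#}" "sum_mset T = 0"
  shows "T = S"
  using assms unfolding minimal_zero_sum_def subset_mset.less_le by blast

lemma minimal_zero_sum_uminus:
  assumes "minimal_zero_sum S"
  shows "minimal_zero_sum (image_mset uminus S)"
proof -
  have sum_neg: "sum_mset (image_mset uminus A) = - sum_mset A" for A :: "int multiset"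
    by (induction A) auto
  have neg_neg: "image_mset uminus (image_mset uminus A) = A" for A :: "int multiset"
    by (induction A) auto
  show ?thesis
    unfolding minimal_zero_sum_def zero_sum_def
  proof (intro conjI allI impI)
    show "sum_mset (image_mset uminus S) = 0"
      using assms by (simp add: sum_neg minimal_zero_sum_def zero_sum_def)
  next
    fix T assume T: "T \<noteq> {#} \<and> T \<subset># image_mset uminus S"
    then have "image_mset uminus T \<subset># S"
      using image_mset_subset_mono[of T "image_mset uminus S" uminus] unfolding neg_neg by blast
    then have "sum_mset (image_mset uminus T) \<noteq> 0"
      using assms T unfolding minimal_zero_sum_def by (metis image_mset_is_empty_iff)
    then show "sum_mset T \<noteq> 0" by (simp add: sum_neg)
  qed
qed

text \<open>A zero-sum subsequence using the merged term lifts, with the same sum, to one using both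
  \<open>a\<close> and \<open>b\<close>; it stays proper.\<close>

lemma minimal_zero_sum_merge:
  assumes "minimal_zero_sum (add_mset a (add_mset b R))"
  shows "minimal_zero_sum (add_mset (a + b) R)"
  unfolding minimal_zero_sum_def zero_sum_def
proof (intro conjI allI impI)
  show "sum_mset (add_mset (a + b) R) = 0"
    using assms by (simp add: minimal_zero_sum_def zero_sum_def)
next
  fix T assume T: "T \<noteq> {#} \<and> T \<subset># add_mset (a + b) R"
  show "sum_mset T \<noteq> 0"
  \<comment> \<open>The value \<open>a + b\<close> may also occur in \<open>R\<close>, so the split
    is on containment in \<open>R\<close> and not on membership of \<open>a + b\<close> in
    \<open>T\<close>.\<close>
  proof (cases "T \<subseteq># R")
    case True
    then have "T \<subset># add_mset a (add_mset b R)"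
      using subset_mset.less_trans[OF multi_psub_of_add_self multi_psub_of_add_self]
      by (rule subset_mset.le_less_trans)
    then show ?thesis using assms T unfolding minimal_zero_sum_def by blast
  next
    case False
    have "T - {#a + b#} \<subseteq># R"
      using T by (simp add: subset_eq_diff_conv subset_mset.less_imp_le)
    then have "a + b \<in># T"
      using False by (metis diff_single_trivial)
    then obtain T' where T': "T = add_mset (a + b) T'" by (metis multi_member_split)
    then have "T' \<subset># R" using T by simp
    then have "add_mset a (add_mset b T') \<subset># add_mset a (add_mset b R)" by simp
    then have "sum_mset (add_mset a (add_mset b T')) \<noteq> 0"
      using assms unfolding minimal_zero_sum_def by (metis add_mset_not_empty)
    then show ?thesis using T' by (simp add: algebra_simps)
  qed
qed

text \<open>Two equal partial sums would enclose a block of sum zero. The full sum is left out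
  because it equals the empty one; this makes the block proper.\<close>

lemma partial_sums_distinct:
  fixes xs :: "int list"
  assumes "minimal_zero_sum (mset xs)"
  shows "inj_on (\<lambda>i. sum_list (take i xs)) {..<length xs}"
proof (rule linorder_inj_onI')
  fix i j assume ij: "i \<in> {..<length xs}" "j \<in> {..<length xs}" "i < j"
  define T where "T = drop i (take j xs)"
  have take_j: "take j xs = take i xs @ T"
    using ij by (simp add: T_def) (metis append_take_drop_id min.absorb1 less_imp_le take_take)
  then have "xs = take i xs @ T @ drop j xs" by (metis append.assoc append_take_drop_id)
  then have "mset xs = mset T + (mset (take i xs) + mset (drop j xs))"
    by (metis mset_append add.assoc add.commute)
  then have sub: "mset T \<subseteq># mset xs" by simp
  have len: "length T = j - i" using ij by (simp add: T_def)
  then have "T \<noteq> []" "mset T \<noteq> mset xs" using ij by (auto dest!: mset_eq_length)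
  then have "sum_list T \<noteq> 0"
    using minimal_zero_sumD[OF assms sub] by (auto simp: sum_mset_sum_list)
  then show "sum_list (take i xs) \<noteq> sum_list (take j xs)" by (simp add: take_j)
qed

section \<open>The bound on \<open>low\<close> from a greedy walk\<close>

lemma sum_mset_pos:
  fixes T :: "int multiset"
  assumes "T \<noteq> {#}" "\<And>x. x \<in># T \<Longrightarrow> x > 0"
  shows "sum_mset T > 0"
  using assms by (induction T) (auto, metis add_pos_pos add.right_neutral sum_mset.empty)

lemma sum_mset_neg:
  fixes T :: "int multiset"
  assumes "T \<noteq> {#}" "\<And>x. x \<in># T \<Longrightarrow> x < 0"
  shows "sum_mset T < 0"
  using assms by (induction T) (auto, metis add_neg_neg add.right_neutral sum_mset.empty)

text \<open>A greedy walk: at a negative partial sum take a positive term, at a partial sum in \<open>{0..<v}\<close> take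
  a positive term of size at most \<open>A - v\<close> while there is one, and otherwise a negative term. No negative
  partial sum occurs before the small positive terms are used up.\<close>

lemma exists_low_arrangement:
  fixes v A :: int
  assumes "A \<ge> 1" "sum_mset S = 0" "set_mset S \<subseteq> {-v..A}" "0 \<notin># S" "k \<le> size S" and v: "v \<ge> 0"
  shows "\<exists>xs. length xs = k \<and> mset xs \<subseteq># S \<and> sum_list xs \<in> {-v..<A} \<and>
    (\<forall>i<k. xs ! i < 0 \<or> xs ! i \<le> A - v \<longrightarrow> sum_list (take i xs) \<in> {0..<A}) \<and>
    ((\<exists>e \<in># S - mset xs. 0 < e \<and> e \<le> A - v) \<longrightarrow> sum_list xs \<ge> 0)"
  using assms(5)
proof (induction k)
  case 0
  then show ?case using v assms(1) by simp
next
  case (Suc k)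
  then obtain xs where xs: "length xs = k" "mset xs \<subseteq># S" "sum_list xs \<in> {-v..<A}"
      "\<And>i. i < k \<Longrightarrow> xs ! i < 0 \<or> xs ! i \<le> A - v \<Longrightarrow> sum_list (take i xs) \<in> {0..<A}"
      "(\<exists>e \<in># S - mset xs. 0 < e \<and> e \<le> A - v) \<Longrightarrow> sum_list xs \<ge> 0"
    by auto
  define R where "R = S - mset xs"
  define s where "s = sum_list xs"
  have S: "S = mset xs + R" using xs(2) by (simp add: R_def)
  have "size R \<noteq> 0" using Suc.prems S xs(1)
    by (metis Suc_n_not_le_n add.right_neutral size_mset size_union)
  then have R: "R \<noteq> {#}" by auto
  have sumR: "sum_mset R = - s" using assms(2) S by (simp add: sum_mset_sum_list s_def)
  have box: "e \<in> {-v..A}" "e \<noteq> 0" if "e \<in># R" for e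
    using that S assms(3,4) by auto
  let ?small = "\<lambda>e. 0 < e \<and> e \<le> A - v"
  have "\<exists>e\<in>#R. s + e \<in> {-v..<A} \<and> (e < 0 \<or> e \<le> A - v \<longrightarrow> s \<in> {0..<A}) \<and>
     ((\<exists>e' \<in># R - {#e#}. ?small e') \<longrightarrow> s + e \<ge> 0)"
  proof (cases "s < 0")
    case True
    then have nosmall: "\<not> (\<exists>e\<in>#R. ?small e)" using xs(5) unfolding R_def s_def by linarith
    obtain e where e: "e \<in># R" "e > 0"
      using sum_mset_neg[OF R] sumR True box by (metis neg_equal_0_iff_equal neg_less_0_iff_less not_less_iff_gr_or_eq)
    \<comment> \<open>The chosen term is too large to be a counted one, so the condition on the sum
      it starts from is vacuous.\<close>
    have "\<not> e \<le> A - v" using nosmall e by auto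
    moreover have "\<not> (\<exists>e' \<in># R - {#e#}. ?small e')" using nosmall by (meson in_diffD)
    ultimately show ?thesis
      using e True xs(3) box[OF e(1)] unfolding s_def[symmetric] by (intro bexI[of _ e]) auto
  next
    case False
    have sA: "s \<in> {0..<A}" using False xs(3) by (auto simp: s_def)
    show ?thesis
    \<comment> \<open>From below \<open>v\<close>, a step of at most \<open>A - v\<close> stays
      below \<open>A\<close>; from \<open>v\<close> on, a negative step keeps the sum
      nonnegative.\<close>
    proof (cases "s < v \<and> (\<exists>e\<in>#R. ?small e)")
      case True
      then obtain e where "e \<in># R" "?small e" by blast
      then show ?thesis using sA True by (intro bexI[of _ e]) auto
    next
      case no: False
      obtain e where e: "e \<in># R" "e < 0"
        using sum_mset_pos[OF R] sumR False box by (metis neg_0_less_iff_less not_less_iff_gr_or_eq)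
      have "s + e \<ge> 0" if "\<exists>e' \<in># R - {#e#}. ?small e'"
        using that no box[OF e(1)] by (auto dest: in_diffD)
      then show ?thesis using e sA box[OF e(1)] by (intro bexI[of _ e]) auto
    qed
  qed
  then obtain e where e: "e \<in># R" "s + e \<in> {-v..<A}"
      "e < 0 \<or> e \<le> A - v \<longrightarrow> s \<in> {0..<A}"
      "(\<exists>e' \<in># R - {#e#}. ?small e') \<longrightarrow> s + e \<ge> 0" by blast
  have "mset (xs @ [e]) \<subseteq># S" using e(1) S by simp
  moreover have "S - mset (xs @ [e]) = R - {#e#}" by (simp add: R_def)
  moreover have "(xs @ [e]) ! i < 0 \<or> (xs @ [e]) ! i \<le> A - v \<longrightarrow>
      sum_list (take i (xs @ [e])) \<in> {0..<A}" if "i < Suc k" for i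
    using that xs(1) xs(4)[of i] e(3) by (cases "i = k") (auto simp: nth_append s_def)
  ultimately show ?case using xs(1) e(2,4) by (intro exI[of _ "xs @ [e]"]) (simp add: s_def)
qed

text \<open>In the greedy arrangement each counted term is added to a partial sum in
  \<open>{0..<A}\<close>. By minimality these sums are distinct, so at most \<open>A\<close> terms
  are counted.\<close>

lemma low_le:
  fixes v A :: int
  assumes "A \<ge> 1" "v \<ge> 0" "minimal_zero_sum S" "set_mset S \<subseteq> {-v..A}" "0 \<notin># S"
  shows "int (low (A - v) S) \<le> A"
proof -
  have "sum_mset S = 0"
    using assms(3) by (simp add: minimal_zero_sum_def zero_sum_def)
  from exists_low_arrangement[OF assms(1) this assms(4,5) order.refl assms(2)]
  obtain xs where len: "length xs = size S" and sub: "mset xs \<subseteq># S"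
    and marked: "\<forall>i<size S. xs ! i < 0 \<or> xs ! i \<le> A - v \<longrightarrow> sum_list (take i xs) \<in> {0..<A}"
    by (elim exE conjE)
  have S: "mset xs = S" using len sub
    by (metis mset_subset_size size_mset subset_mset.le_imp_less_or_eq less_irrefl)
  let ?I = "{i. i < length xs \<and> (xs ! i < 0 \<or> xs ! i \<le> A - v)}"
  have "low (A - v) S = length (filter (\<lambda>e. e < 0 \<or> e \<le> A - v) xs)"
    unfolding low_def by (metis S mset_filter size_mset)
  also have "\<dots> = card ?I" by (rule length_filter_conv_card)
  also have "\<dots> = card ((\<lambda>i. sum_list (take i xs)) ` ?I)"
    by (intro card_image[symmetric] inj_on_subset[OF partial_sums_distinct])
      (use assms(3) S in auto)
  also have "\<dots> \<le> card {0..<A}"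
    using marked len by (intro card_mono) auto
  finally show ?thesis using assms(1) by simp
qed

section \<open>Splitting by sign and merging pairs\<close>

text \<open>Lists rather than multisets, because after sorting the terms are paired by
  position.\<close>

definition signed :: "int list \<Rightarrow> int list \<Rightarrow> int multiset" where
  "signed P N = mset P + image_mset uminus (mset N)"

definition merged :: "nat \<Rightarrow> int list \<Rightarrow> int list \<Rightarrow> int multiset" where
  "merged t P N = mset (map2 (-) (take t P) (take t N)) + signed (drop t P) (drop t N)"

lemma merged_0: "merged 0 P N = signed P N"
  by (simp add: merged_def)

lemma merged_step:
  assumes "t < length P" "t < length N"
  obtains R where "merged t P N = add_mset (P ! t) (add_mset (- (N ! t)) R)"
    and "merged (Suc t) P N = add_mset (P ! t - N ! t) R"
proof
  let ?R = "mset (map2 (-) (take t P) (take t N)) + signed (drop (Suc t) P) (drop (Suc t) N)"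
  show "merged t P N = add_mset (P ! t) (add_mset (- (N ! t)) ?R)"
    using assms by (simp add: merged_def signed_def flip: Cons_nth_drop_Suc)
  show "merged (Suc t) P N = add_mset (P ! t - N ! t) ?R"
    using assms by (simp add: merged_def signed_def take_Suc_conv_app_nth)
qed

lemma minimal_zero_sum_merged:
  assumes "minimal_zero_sum (signed P N)" "t \<le> length P" "t \<le> length N"
  shows "minimal_zero_sum (merged t P N)"
  using assms(2,3)
proof (induction t)
  case 0
  then show ?case using assms(1) by (simp add: merged_0)
next
  case (Suc t)
  then obtain R where "merged t P N = add_mset (P ! t) (add_mset (- (N ! t)) R)"
    "merged (Suc t) P N = add_mset (P ! t - N ! t) R"
    using merged_step[of t P N] by auto
  then show ?case
    using Suc minimal_zero_sum_merge[of "P ! t" "- (N ! t)" R] by simp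
qed

lemma mem_mergedE:
  assumes "e \<in># merged t P N" "t \<le> length P" "t \<le> length N"
  obtains i where "i < t" "e = P ! i - N ! i"
    | i where "t \<le> i" "i < length P" "e = P ! i"
    | i where "t \<le> i" "i < length N" "e = - (N ! i)"
proof -
  have drop: "\<exists>i. t \<le> i \<and> i < length xs \<and> x = xs ! i"
    if x: "x \<in> set (drop t xs)" and t: "t \<le> length xs" for x :: int and xs
  proof -
    from x obtain h where "h < length (drop t xs)" "drop t xs ! h = x"
      by (metis in_set_conv_nth)
    then show ?thesis using t by (intro exI[of _ "t + h"]) auto
  qed
  consider "e \<in> set (map2 (-) (take t P) (take t N))" | "e \<in> set (drop t P)"
    | "- e \<in> set (drop t N)"
    using assms(1) by (auto simp: merged_def signed_def)
  then show thesis
  proof cases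
    case 1
    then show thesis using assms(2,3) that(1) by (auto simp: set_zip)
  next
    case 2
    then show thesis using drop assms(2) that(2) by blast
  next
    case 3
    then obtain i where "t \<le> i" "i < length N" "- e = N ! i" using drop assms(3) by blast
    then show thesis using that(3)[of i] by simp
  qed
qed

lemma size_merged:
  assumes "t \<le> length P" "t \<le> length N"
  shows "size (merged t P N) = length P + length N - t"
  using assms by (simp add: merged_def signed_def)

lemma low_signed:
  assumes "\<forall>p \<in> set P. p > 0" "\<forall>n \<in> set N. n > 0"
  shows "low d (signed P N) = length N + low d (mset P)"
proof -
  have "low d (image_mset uminus (mset N)) = length N"
    using assms(2) by (subst low_eq_size) auto
  then show ?thesis by (simp add: signed_def low_union)
qed

lemma uminus_signed: "image_mset uminus (signed P N) = signed N P"
  by (simp add: signed_def multiset.map_comp o_def)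

lemma obtain_signed:
  assumes "0 \<notin># S"
  obtains P N where "S = signed P N" "sorted_wrt (\<ge>) P" "sorted_wrt (\<ge>) N"
    "\<forall>p \<in> set P. p > 0" "\<forall>n \<in> set N. n > 0"
proof
  let ?P = "rev (sorted_list_of_multiset {#e \<in># S. e > 0#})"
  let ?N = "rev (sorted_list_of_multiset (image_mset uminus {#e \<in># S. e < 0#}))"
  have "S = {#e \<in># S. e > 0#} + {#e \<in># S. e < 0#}"
    using assms by (induction S) auto
  then show "S = signed ?P ?N"
    by (simp add: signed_def multiset.map_comp o_def)
  show "sorted_wrt (\<ge>) ?P" "sorted_wrt (\<ge>) ?N"
    by (simp_all add: sorted_wrt_rev)
  show "\<forall>p \<in> set ?P. p > 0" "\<forall>n \<in> set ?N. n > 0" by auto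
qed


text \<open>Holds for negative \<open>d\<close> too: without zeros, \<open>low 0\<close> counts
  exactly the negative terms, which \<open>low d\<close> always counts. It turns bounds on
  \<open>low\<close> into bounds on the number of terms of one sign.\<close>

lemma low_0_le: "0 \<notin># S \<Longrightarrow> low 0 S \<le> low d S"
  by (induction S) (auto simp: low_def)

lemma low_drop:
  assumes "\<And>h. h < i \<Longrightarrow> h < length P \<Longrightarrow> P ! h \<ge> 0 \<and> P ! h > d"
  shows "low d (mset P) = low d (mset (drop i P))"
proof -
  have "low d (mset (take i P)) = 0"
    using assms by (intro low_eq_0) (auto simp: in_set_conv_nth)
  then show ?thesis
    by (metis add.left_neutral append_take_drop_id low_union mset_append)
qed

text \<open>Such a pair cancels, so by minimality it is the whole sequence. In longer sequences
  merging therefore creates no zero.\<close>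

lemma length_add_eq_2_if_nth_eq:
  assumes "minimal_zero_sum (signed P N)" "i < length P" "i < length N" "P ! i = N ! i"
  shows "length P + length N = 2"
proof -
  have "{#P ! i#} \<subseteq># mset P" "{#- (N ! i)#} \<subseteq># image_mset uminus (mset N)"
    using assms(2,3) by auto
  then have "{#P ! i#} + {#- (N ! i)#} \<subseteq># signed P N"
    unfolding signed_def by (rule subset_mset.add_mono)
  then have "{#P ! i#} + {#- (N ! i)#} = signed P N"
    by (rule minimal_zero_sumD[OF assms(1)]) (use assms(4) in auto)
  then have "size (signed P N) = 2" by (metis One_nat_def size_single size_union one_add_one)
  then show ?thesis by (simp add: signed_def)
qed

lemma zero_not_mem_merged:
  assumes "t \<le> length P" "t \<le> length N" "\<And>i. i < t \<Longrightarrow> P ! i \<noteq> N ! i"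
    "\<forall>p \<in> set P. p > 0" "\<forall>n \<in> set N. n > 0"
  shows "0 \<notin># merged t P N"
proof
  assume "0 \<in># merged t P N"
  then show False
    using assms by (elim mem_mergedE) (force simp: in_set_conv_nth)+
qed

section \<open>Choosing the pairs to merge\<close>

text \<open>Rules out the configuration in which the sorted pairing of \<open>exists_pairing\<close> fails: a pair \<open>j\<close> with
  negative sum, followed by a pair \<open>i\<close> whose sum is too large. The first \<open>i\<close> merged terms then lie so low
  that \<open>low_le\<close> leaves little room for the negative terms.\<close>

lemma flip_gap:
  fixes m M q :: int
  assumes min: "minimal_zero_sum (signed P N)"
    and pos: "\<forall>p \<in> set P. p > 0" "\<forall>n \<in> set N. n > 0"
    and sorted: "sorted_wrt (\<ge>) P" "sorted_wrt (\<ge>) N"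
    and q: "q \<le> m" "q = N ! j" "P ! j < q" "m < M"
    and i: "j < i" "i < length P" "i \<le> length N" "M - q < P ! i"
    and before_j: "\<And>h. h < j \<Longrightarrow> N ! h \<le> P ! h"
    and before_i: "\<And>h. h < i \<Longrightarrow> P ! h \<noteq> N ! h \<and> P ! h - N ! h \<le> M - q"
    and gap: "i < length N \<Longrightarrow> M - q < P ! i - N ! i"
  shows "int (length N + low (M - m) (mset P)) \<le> q"
proof -
  define a where "a = P ! i"
  define T where "T = merged i P N"
  have P_mono: "P ! h' \<le> P ! h" if "h \<le> h'" "h' < length P" for h h'
    using sorted_wrt_nth_less[OF sorted(1), of h h'] that by (cases "h = h'") auto
  have N_mono: "N ! h' \<le> N ! h" if "h \<le> h'" "h' < length N" for h h'
    using sorted_wrt_nth_less[OF sorted(2), of h h'] that by (cases "h = h'") auto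
  have a: "a > 0" "M - q < a" "a < q"
    using pos i P_mono[of j i] q by (auto simp: a_def)
  have minT: "minimal_zero_sum T" unfolding T_def
    using min i by (intro minimal_zero_sum_merged) auto
  have zero: "0 \<notin># T" unfolding T_def
    using i before_i pos by (intro zero_not_mem_merged) auto
  \<comment> \<open>The bound \<open>a - q\<close> serves the pairs: those before \<open>j\<close>
    merge to nonnegative numbers, the others have \<open>P ! h\<close> at least \<open>a\<close> and
    \<open>N ! h\<close> at most \<open>q\<close>. The bound \<open>M - q - a\<close> serves the
    unpaired negative terms, by \<open>gap\<close>.\<close>
  have box: "e \<le> a \<and> (e \<ge> a - q \<or> e \<ge> M - q - a)" if "e \<in># T" for e
    using that[unfolded T_def] less_imp_le[OF i(2)] i(3)
  proof (cases rule: mem_mergedE)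
    case (1 h)
    have "e \<ge> a - q"
    proof (cases "h < j")
      case True
      then show ?thesis using before_j[of h] 1 a by simp
    next
      case False
      then have "N ! h \<le> q" "a \<le> P ! h"
        using N_mono[of j h] P_mono[of h i] 1 i by (auto simp: q(2) a_def)
      then show ?thesis using 1 by simp
    qed
    then show ?thesis using before_i[of h] 1 a by simp
  next
    case (2 h)
    have "e > 0" using 2 pos(1) by simp
    then show ?thesis using 2 P_mono[of i h] a by (auto simp: a_def)
  next
    case (3 h)
    then have "N ! h \<le> N ! i" "N ! h > 0" using N_mono[of i h] pos(2) by auto
    then show ?thesis using 3 gap a by (auto simp: a_def)
  qed
  have large: "P ! h > M - q" "P ! h > M - m" "P ! h \<ge> 0" if "h \<le> i" for h
    using P_mono[OF that] i a q(1) by (auto simp: a_def)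
  \<comment> \<open>The sign of \<open>2 * a - M\<close> decides which lower bound in
    \<open>box\<close> is the weaker one. In the first case the threshold in \<open>low_le\<close>
    is \<open>M - q\<close>, so all \<open>i\<close> merged terms are counted and replace the
    \<open>i\<close> negative terms they absorbed.\<close>
  show ?thesis
  proof (cases "2 * a \<ge> M")
    case True
    have "set_mset T \<subseteq> {-(a + q - M)..a}" using box True by force
    then have "int (low (M - q) T) \<le> a"
      using low_le[of a "a + q - M" T] a minT zero by simp
    moreover have "low (M - q) T \<ge> length N + low (M - m) (mset P)"
    proof -
      have "low (M - q) (mset (map2 (-) (take i P) (take i N))) = i"
        using i before_i by (subst low_eq_size) (auto simp: set_zip)
      moreover have "low (M - q) (signed (drop i P) (drop i N)) =
          (length N - i) + low (M - q) (mset (drop i P))"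
        using pos by (subst low_signed) (auto dest: in_set_dropD)
      moreover have "low (M - m) (mset P) = low (M - m) (mset (drop i P))"
        using large by (intro low_drop) auto
      moreover have "low (M - m) (mset (drop i P)) \<le> low (M - q) (mset (drop i P))"
        using q by (intro low_mono) simp
      ultimately show ?thesis using i by (simp add: T_def merged_def low_union)
    qed
    ultimately show ?thesis using a by linarith
  next
    \<comment> \<open>Applying \<open>low_le\<close> to \<open>T\<close> and to its negation bounds
      the negative terms by \<open>a\<close> and the positive ones by \<open>q - a\<close>, so
      \<open>size T\<close> is at most \<open>q\<close>. Each merge costs one term, but the entry of
      \<open>P\<close> involved exceeds \<open>M - m\<close> and is not counted by
      \<open>low\<close>.\<close>
    case False
    have "set_mset T \<subseteq> {-(q - a)..a}" using box False by force
    moreover from this have "set_mset (image_mset uminus T) \<subseteq> {-a..q - a}" by force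
    moreover have zero_uminus: "0 \<notin># image_mset uminus T" using zero by auto
    ultimately have "int (low (a - (q - a)) T) \<le> a"
      "int (low ((q - a) - a) (image_mset uminus T)) \<le> q - a"
      using low_le[of a "q - a" T] low_le[of "q - a" a "image_mset uminus T"] a minT zero
        minimal_zero_sum_uminus[OF minT] zero_uminus
      by simp_all
    moreover have "low 0 T \<le> low (a - (q - a)) T"
      "low 0 (image_mset uminus T) \<le> low ((q - a) - a) (image_mset uminus T)"
      using zero by (auto intro!: low_0_le)
    moreover have "size T = low 0 T + low 0 (image_mset uminus T)"
      using zero by (rule size_eq_low_plus_low)
    moreover have "size T = length P + length N - i"
      unfolding T_def using i by (intro size_merged) auto
    moreover have "low (M - m) (mset P) \<le> length P - Suc i"
    proof -
      have "low (M - m) (mset P) = low (M - m) (mset (drop (Suc i) P))"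
        using large by (intro low_drop) auto
      also have "\<dots> \<le> size (mset (drop (Suc i) P))" by (rule low_le_size)
      finally show ?thesis by simp
    qed
    ultimately show ?thesis using i by linarith
  qed
qed


text \<open>Largest positive terms are paired with largest negative ones, so that the merged
  sequence fits into \<open>{-m'..M - m'}\<close>. The last alternative for a pair says that a
  negative merged term is small enough to count as well in the bound on positive terms for the new
  interval.\<close>

lemma exists_pairing:
  fixes m M :: int
  assumes m: "0 < m" "m < M"
    and min: "minimal_zero_sum (signed P N)"
    and pos: "\<forall>p \<in> set P. p > 0" "\<forall>n \<in> set N. n > 0"
    and bound: "\<forall>p \<in> set P. p \<le> M" "\<forall>n \<in> set N. n \<le> m"
    and sorted: "sorted_wrt (\<ge>) P" "sorted_wrt (\<ge>) N"
    and large: "int (length N + low (M - m) (mset P)) > m + 1"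
  obtains t m' where "t \<le> length P" "t \<le> length N" "0 < m'" "m' \<le> m"
    "\<And>i. i < t \<Longrightarrow> M - m < P ! i \<and> P ! i \<noteq> N ! i \<and> P ! i - N ! i \<le> M - m' \<and>
      (P ! i > N ! i \<or> P ! i - N ! i \<ge> M - 2 * m')"
    "\<And>i. t \<le> i \<Longrightarrow> i < length P \<Longrightarrow> P ! i \<le> M - m'"
    "\<And>i. t \<le> i \<Longrightarrow> i < length N \<Longrightarrow> N ! i \<le> m'"
proof -
  have P_mono: "P ! h' \<le> P ! h" if "h \<le> h'" "h' < length P" for h h'
    using sorted_wrt_nth_less[OF sorted(1), of h h'] that by (cases "h = h'") auto
  have N_mono: "N ! h' \<le> N ! h" if "h \<le> h'" "h' < length N" for h h'
    using sorted_wrt_nth_less[OF sorted(2), of h h'] that by (cases "h = h'") auto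
  have P_box: "0 < P ! i" "P ! i \<le> M" if "i < length P" for i
    using pos bound that by auto
  have N_box: "0 < N ! i" "N ! i \<le> m" if "i < length N" for i
    using pos bound that by auto
  have neq: "P ! i \<noteq> N ! i" if "i < length P" "i < length N" for i
  proof
    assume "P ! i = N ! i"
    then have "length P + length N = 2" using length_add_eq_2_if_nth_eq[OF min that] by simp
    then show False using large m low_le_size[of "M - m" "mset P"] by simp
  qed
  \<comment> \<open>A flip is a pair whose sum of absolute values exceeds \<open>M\<close> although
    its merged value is negative. Without flips one merges up to the first \<open>t\<close> with
    \<open>P ! t + N ! t\<close> at most \<open>M\<close> and takes \<open>m' = N ! t\<close>;
    otherwise the first flip \<open>j\<close> gives \<open>m' = N ! j\<close>.\<close>
  define flip where "flip j \<longleftrightarrow> j < length P \<and> j < length N \<and> P ! j < N ! j \<and> M < P ! j + N ! j" for j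
  show thesis
  proof (cases "\<exists>j. flip j")
    case False
    define t where "t = (LEAST c. \<not> (c < length P \<and> c < length N \<and> M < P ! c + N ! c))"
    have t: "\<not> (t < length P \<and> t < length N \<and> M < P ! t + N ! t)"
      unfolding t_def by (rule LeastI[of _ "length P"]) simp
    have before: "i < length P \<and> i < length N \<and> M < P ! i + N ! i" if "i < t" for i
      using not_less_Least[of i] that unfolding t_def by blast
    have t_le: "t \<le> length P" "t \<le> length N"
      using before by (meson less_irrefl not_le)+
    have less: "N ! i < P ! i" if "i < t" for i
      using False before[OF that] neq[of i] unfolding flip_def by force
    \<comment> \<open>Otherwise all negative terms are absorbed into positive ones, and the sum
      cannot be zero.\<close>
    have "t < length N"
    proof (rule ccontr)
      assume "\<not> t < length N"
      then have t_eq: "t = length N" using t_le by simp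
      have "length P \<noteq> 0"
      proof
        assume "length P = 0"
        then show False using t_eq t_le large m by (simp add: low_def)
      qed
      moreover have "size (merged t P N) = length P" using size_merged[OF t_le] t_eq by simp
      ultimately have "merged t P N \<noteq> {#}" by auto
      moreover have "e > 0" if "e \<in># merged t P N" for e
        using that t_le by (rule mem_mergedE) (use less P_box t_eq in auto)
      ultimately have "sum_mset (merged t P N) > 0" by (rule sum_mset_pos)
      then show False
        using minimal_zero_sum_merged[OF min t_le]
        by (simp add: minimal_zero_sum_def zero_sum_def)
    qed
    show thesis
    proof (rule that[of t "N ! t"])
      show "t \<le> length P" "t \<le> length N" "0 < N ! t" "N ! t \<le> m"
        using t_le N_box \<open>t < length N\<close> by auto
    next
      fix i assume "i < t"
      then show "M - m < P ! i \<and> P ! i \<noteq> N ! i \<and> P ! i - N ! i \<le> M - N ! t \<and>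
          (P ! i > N ! i \<or> P ! i - N ! i \<ge> M - 2 * N ! t)"
        using before[of i] less[of i] N_box[of i] P_box[of i] N_mono[of i t] \<open>t < length N\<close> by auto
    next
      fix i assume "t \<le> i" "i < length P"
      then show "P ! i \<le> M - N ! t" using t P_mono[of t i] \<open>t < length N\<close> by auto
    next
      fix i assume "t \<le> i" "i < length N"
      then show "N ! i \<le> N ! t" using N_mono by simp
    qed
  next
    case True
    define j where "j = (LEAST j. flip j)"
    have flip_j: "flip j" unfolding j_def using True by (rule LeastI_ex)
    define q where "q = N ! j"
    have j: "j < length P" "j < length N" "P ! j < q" "M < P ! j + q"
      using flip_j by (auto simp: flip_def q_def)
    have before_j: "N ! h \<le> P ! h" if "h < j" for h
    proof -
      have "\<not> flip h" using not_less_Least that unfolding j_def by blast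
      then show ?thesis
        using that j P_mono[of h j] N_mono[of h j] by (auto simp: flip_def q_def)
    qed
    have q: "0 < q" "q \<le> m" using N_box j by (auto simp: q_def)
    \<comment> \<open>All positive terms above \<open>M - q\<close> must be merged. The obstacle is
      such a term after \<open>j\<close> with no partner, or with one too small to bring it down to
      \<open>M - q\<close>.\<close>
    define gap where "gap i \<longleftrightarrow> j < i \<and> i < length P \<and> M - q < P ! i \<and> (i < length N \<longrightarrow> M - q < P ! i - N ! i)" for i
    have no_gap: "\<not> gap i" for i
    proof
      assume "gap i"
      define g where "g = (LEAST i. gap i)"
      have gap_g: "gap g" unfolding g_def using \<open>gap i\<close> by (rule LeastI)
      \<comment> \<open>Before the first gap every term has a partner and merges well; hence
        \<open>flip_gap\<close> applies at \<open>g\<close>.\<close>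
      have between: "h < length N \<and> P ! h - N ! h \<le> M - q" if "j \<le> h" "h < g" for h
      proof (cases "h = j")
        case True
        then show ?thesis using j m q by (simp add: q_def)
      next
        case False
        have "\<not> gap h" using not_less_Least that unfolding g_def by blast
        moreover have "M - q < P ! h" using gap_g P_mono[of h g] that by (simp add: gap_def)
        ultimately show ?thesis using that False gap_g by (auto simp: gap_def)
      qed
      have "j < g" using gap_g by (simp add: gap_def)
      then have "g - 1 < length N" using between[of "g - 1"] by simp
      then have "g \<le> length N" by simp
      have "int (length N + low (M - m) (mset P)) \<le> q"
      proof (rule flip_gap[OF min pos sorted q(2) q_def j(3) m(2)])
        show "j < g" "g < length P" "g \<le> length N" "M - q < P ! g"
          using gap_g \<open>g \<le> length N\<close> by (auto simp: gap_def)
        show "N ! h \<le> P ! h" if "h < j" for h using before_j that .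
        show "P ! h \<noteq> N ! h \<and> P ! h - N ! h \<le> M - q" if "h < g" for h
        proof (cases "h < j")
          case True
          then show ?thesis
            using neq[of h] P_box[of h] N_mono[of h j] j by (auto simp: q_def)
        next
          case False
          then show ?thesis using neq[of h] between[of h] that gap_g by (auto simp: gap_def)
        qed
        show "M - q < P ! g - N ! g" if "g < length N" using gap_g that by (simp add: gap_def)
      qed
      then show False using large q by simp
    qed
    define t where "t = (LEAST t. \<not> (t < length P \<and> M - q < P ! t))"
    have t: "\<not> (t < length P \<and> M - q < P ! t)"
      unfolding t_def by (rule LeastI[of _ "length P"]) simp
    have before_t: "i < length P \<and> M - q < P ! i" if "i < t" for i
      using not_less_Least[of i] that unfolding t_def by blast
    have "j < t" using t j P_mono[of t j] by (meson diff_less_eq le_less_trans not_le order.strict_trans1)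
    have t_P: "t \<le> length P" using before_t by (meson less_irrefl not_le)
    have paired: "i < length N \<and> P ! i - N ! i \<le> M - q" if "i < t" for i
    proof (cases "i < j")
      case True
      then show ?thesis using P_box[of i] N_mono[of i j] j by (auto simp: q_def)
    next
      case False
      then show ?thesis
        using no_gap[of i] before_t[OF that] j m q by (cases "i = j") (auto simp: gap_def q_def)
    qed
    have t_N: "t \<le> length N" using paired by (meson less_irrefl not_le)
    show thesis
    proof (rule that[of t q])
      show "t \<le> length P" "t \<le> length N" "0 < q" "q \<le> m" by fact+
    next
      fix i assume i: "i < t"
      have "P ! i > N ! i \<or> P ! i - N ! i \<ge> M - 2 * q"
      proof (cases "i < j")
        case True
        then show ?thesis using before_j[of i] neq[of i] before_t[OF i] paired[OF i] by force
      next
        case False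
        then have "N ! i \<le> q" using N_mono[of j i] paired[OF i] by (simp add: q_def)
        then show ?thesis using before_t[OF i] by simp
      qed
      then show "M - m < P ! i \<and> P ! i \<noteq> N ! i \<and> P ! i - N ! i \<le> M - q \<and>
          (P ! i > N ! i \<or> P ! i - N ! i \<ge> M - 2 * q)"
        using before_t[OF i] paired[OF i] neq[of i] q by auto
    next
      fix i assume "t \<le> i" "i < length P"
      then show "P ! i \<le> M - q" using t P_mono[of t i] by auto
    next
      fix i assume "t \<le> i" "i < length N"
      then show "N ! i \<le> q" using N_mono[of j i] \<open>j < t\<close> by (simp add: q_def)
    qed
  qed
qed

section \<open>The Euclidean descent\<close>

text \<open>The pair plays the role of \<open>M - t'\<close> and \<open>m - (t - t')\<close> in
  \<open>rho\<close>. For sequences without zeros \<open>x\<close> bounds the number of negative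
  terms and \<open>y\<close> that of positive terms, so \<open>x + y\<close> bounds the
  length.\<close>

definition coprime_bounds :: "int \<Rightarrow> int \<Rightarrow> int multiset \<Rightarrow> bool" where
  "coprime_bounds m M S \<longleftrightarrow> (\<exists>x y. coprime x y \<and> int (low (M - m) S) \<le> x \<and> x \<le> M \<and>
     int (low (m - M) (image_mset uminus S)) \<le> y \<and> y \<le> m)"

lemma coprime_bounds_uminus:
  "coprime_bounds M m (image_mset uminus S) \<Longrightarrow> coprime_bounds m M S"
  unfolding coprime_bounds_def by (simp add: multiset.map_comp o_def) (metis coprime_commute)

text \<open>Every merged term is positive or small enough to count, so \<open>y\<close> is at least
  \<open>length P\<close>, while \<open>x\<close> is at least \<open>length N - t\<close>. Since the
  \<open>t\<close> merged entries of \<open>P\<close> exceed \<open>M - m\<close>, the sum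
  \<open>x + y\<close> dominates \<open>low (M - m)\<close>; and adding \<open>y\<close> preserves
  coprimality.\<close>

lemma coprime_bounds_merged:
  assumes t: "t \<le> length P" "t \<le> length N" and m: "m' \<le> m" "m < M"
    and pos: "\<forall>p \<in> set P. p > 0" "\<forall>n \<in> set N. n > 0"
    and paired: "\<And>i. i < t \<Longrightarrow> M - m < P ! i \<and> (P ! i > N ! i \<or> P ! i - N ! i \<ge> M - 2 * m')"
    and bounds: "coprime_bounds m' (M - m') (merged t P N)"
  shows "coprime_bounds m M (signed P N)"
proof -
  obtain x y where xy: "coprime x y" "int (low (M - m' - m') (merged t P N)) \<le> x" "x \<le> M - m'"
      "int (low (m' - (M - m')) (image_mset uminus (merged t P N))) \<le> y" "y \<le> m'"
    using bounds unfolding coprime_bounds_def by blast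
  have "length N - t \<le> low (M - m' - m') (merged t P N)"
    using pos by (simp add: merged_def low_union low_signed in_set_dropD)
  moreover have "low (m' - (M - m')) (image_mset uminus (merged t P N)) \<ge> length P"
  proof -
    have "low (m' - (M - m')) (image_mset uminus (mset (map2 (-) (take t P) (take t N)))) = t"
      using t paired by (subst low_eq_size) (force simp: set_zip)+
    moreover have "low (m' - (M - m')) (image_mset uminus (signed (drop t P) (drop t N))) \<ge> length P - t"
      using pos by (simp add: uminus_signed low_signed in_set_dropD)
    ultimately show ?thesis using t by (simp add: merged_def low_union)
  qed
  ultimately have lower: "int (length N) - int t \<le> x" "int (length P) \<le> y" using xy t by auto
  have "low (M - m) (mset P) = low (M - m) (mset (drop t P))"
    using paired pos m by (intro low_drop) (auto intro: less_imp_le)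
  also have "\<dots> \<le> length P - t" using low_le_size[of _ "mset (drop t P)"] by simp
  finally have "int (low (M - m) (signed P N)) \<le> x + y"
    using lower t pos by (simp add: low_signed)
  moreover have "low (m - M) (mset N) = 0"
    using pos m by (intro low_eq_0) force
  then have "int (low (m - M) (image_mset uminus (signed P N))) \<le> y"
    using lower pos by (simp add: uminus_signed low_signed)
  moreover have "coprime (x + y) y" using xy(1) by (simp add: coprime_iff_gcd_eq_1)
  ultimately show ?thesis unfolding coprime_bounds_def using xy m by (intro exI[of _ "x + y"] exI[of _ y]) auto
qed


text \<open>The assumption \<open>smaller\<close> acts as induction hypothesis: the endpoint sum
  drops from \<open>m + M\<close> to \<open>M\<close>.\<close>

lemma coprime_bounds_step:
  assumes m: "0 < m" "m < M"
    and S: "minimal_zero_sum S" "set_mset S \<subseteq> {-m..M}" "0 \<notin># S"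
    and smaller: "\<And>m' T. \<lbrakk>0 < m'; m' \<le> m; minimal_zero_sum T; set_mset T \<subseteq> {-m'..M - m'}; 0 \<notin># T\<rbrakk>
      \<Longrightarrow> coprime_bounds m' (M - m') T"
  shows "coprime_bounds m M S"
proof (cases "int (low (M - m) S) \<le> m + 1")
  case True
  have "set_mset (image_mset uminus S) \<subseteq> {-M..m}" "0 \<notin># image_mset uminus S"
    using S(2,3) by force+
  then have "int (low (m - M) (image_mset uminus S)) \<le> m"
    using m S by (intro low_le minimal_zero_sum_uminus) auto
  moreover have "coprime (m + 1) m" by simp
  ultimately show ?thesis using True m unfolding coprime_bounds_def
    by (intro exI[of _ "m + 1"] exI[of _ m]) auto
next
  case False
  obtain P N where PN: "S = signed P N" "sorted_wrt (\<ge>) P" "sorted_wrt (\<ge>) N"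
      "\<forall>p \<in> set P. p > 0" "\<forall>n \<in> set N. n > 0"
    using obtain_signed[OF S(3)] by blast
  have bound: "\<forall>p \<in> set P. p \<le> M" "\<forall>n \<in> set N. n \<le> m"
    using S(2) by (auto simp: PN(1) signed_def)
  have "int (length N + low (M - m) (mset P)) > m + 1"
    using False PN by (simp add: low_signed)
  then obtain t m' where t: "t \<le> length P" "t \<le> length N" and m': "0 < m'" "m' \<le> m"
    and paired: "\<And>i. i < t \<Longrightarrow> M - m < P ! i \<and> P ! i \<noteq> N ! i \<and> P ! i - N ! i \<le> M - m' \<and>
      (P ! i > N ! i \<or> P ! i - N ! i \<ge> M - 2 * m')"
    and rest: "\<And>i. t \<le> i \<Longrightarrow> i < length P \<Longrightarrow> P ! i \<le> M - m'"
      "\<And>i. t \<le> i \<Longrightarrow> i < length N \<Longrightarrow> N ! i \<le> m'"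
    using exists_pairing[OF m S(1)[unfolded PN(1)] PN(4,5) bound PN(2,3)] by blast
  have "set_mset (merged t P N) \<subseteq> {-m'..M - m'}"
  proof
    fix e assume "e \<in># merged t P N"
    then show "e \<in> {-m'..M - m'}"
      using t
    proof (cases rule: mem_mergedE)
      case (1 i)
      then show ?thesis using paired[of i] m m' by auto
    next
      case (2 i)
      then have "e > 0" using PN(4) by simp
      then show ?thesis using rest 2 m' by simp
    next
      case (3 i)
      then have "e < 0" using PN(5) by simp
      then show ?thesis using rest 3 m m' by simp
    qed
  qed
  moreover have "minimal_zero_sum (merged t P N)"
    using S(1) t unfolding PN(1) by (intro minimal_zero_sum_merged)
  moreover have "0 \<notin># merged t P N"
    using t paired PN(4,5) by (intro zero_not_mem_merged) auto
  ultimately have "coprime_bounds m' (M - m') (merged t P N)"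
    using smaller m' by blast
  then show ?thesis
    unfolding PN(1) using t m' m PN paired by (intro coprime_bounds_merged) auto
qed

text \<open>The descent needs distinct endpoints. Here, if \<open>m\<close> does not occur, the
  interval shrinks to \<open>{-m..m - 1}\<close> and \<open>low_le\<close> leaves room for the pair
  \<open>(m - 1, m)\<close>; negation treats a missing \<open>- m\<close>. If both occur, they are
  the whole sequence.\<close>

lemma coprime_bounds_equal:
  assumes "0 < m" "minimal_zero_sum S" "set_mset S \<subseteq> {-m..m}" "0 \<notin># S"
  shows "coprime_bounds m m S"
proof -
  have uminus_box: "set_mset (image_mset uminus T) \<subseteq> {-m..m}" "0 \<notin># image_mset uminus T"
    if "set_mset T \<subseteq> {-m..m}" "0 \<notin># T" for T
    using that by force+
  have *: "coprime_bounds m m T"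
    if T: "minimal_zero_sum T" "set_mset T \<subseteq> {-m..m}" "0 \<notin># T" "m \<notin># T" for T
  proof -
    have le: "int (low 0 T) \<le> m" "int (low 0 (image_mset uminus T)) \<le> m"
      using low_le[of m m T] low_le[of m m "image_mset uminus T"] assms(1) T(1-3)
        minimal_zero_sum_uminus[OF T(1)] uminus_box[OF T(2,3)] by simp_all
    show ?thesis
    \<comment> \<open>\<open>low_le\<close> requires the upper endpoint \<open>m - 1\<close> to be
      at least 1.\<close>
    proof (cases "m = 1")
      case True
      then show ?thesis
        using le unfolding coprime_bounds_def by (intro exI[of _ 1]) simp
    next
      case False
      have "set_mset T \<subseteq> {-m..m - 1}"
      proof
        fix e assume e: "e \<in># T"
        then have "e \<noteq> m" "e \<in> {-m..m}" using T(2,4) by blast+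
        then show "e \<in> {-m..m - 1}" by simp
      qed
      then have "int (low (m - 1 - m) T) \<le> m - 1"
        using low_le[of "m - 1" m T] T False assms(1) by auto
      then have "int (low 0 T) \<le> m - 1"
        using low_0_le[OF T(3), of "m - 1 - m"] by linarith
      moreover have "coprime (m - 1) m" by (simp add: coprime_diff_one_left)
      ultimately show ?thesis
        using le unfolding coprime_bounds_def by (intro exI[of _ "m - 1"] exI[of _ m]) auto
    qed
  qed
  consider "m \<notin># S" | "- m \<notin># S" | "m \<in># S" "- m \<in># S" by blast
  then show ?thesis
  proof cases
    case 1
    then show ?thesis using * assms by blast
  next
    case 2
    then have "m \<notin># image_mset uminus S" by force
    with minimal_zero_sum_uminus[OF assms(2)] uminus_box[OF assms(3,4)]
    have "coprime_bounds m m (image_mset uminus S)" by (rule *)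
    then show ?thesis by (rule coprime_bounds_uminus)
  next
    case 3
    obtain A where A: "S = add_mset m A" using 3(1) by (meson multi_member_split)
    then have "- m \<in># A" using 3(2) assms(1) by simp
    then have "{#m, - m#} \<subseteq># S" using A by simp
    then have "S = {#m, - m#}" using minimal_zero_sumD[OF assms(2), of "{#m, - m#}"] by simp
    then show ?thesis using assms(1) unfolding coprime_bounds_def
      by (intro exI[of _ 1]) (simp add: low_def)
  qed
qed

lemma coprime_bounds:
  assumes "0 < m" "0 < M" "minimal_zero_sum S" "set_mset S \<subseteq> {-m..M}" "0 \<notin># S"
  shows "coprime_bounds m M S"
  using assms
proof (induction "nat (m + M)" arbitrary: m M S rule: less_induct)
  case less
  consider "m < M" | "m = M" | "M < m" by linarith
  then show ?case
  proof cases
    case 1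
    show ?thesis
    proof (rule coprime_bounds_step)
      fix m' T
      assume "0 < m'" "m' \<le> m" "minimal_zero_sum T" "set_mset T \<subseteq> {-m'..M - m'}" "0 \<notin># T"
      then show "coprime_bounds m' (M - m') T" using 1 less.prems by (intro less.hyps) auto
    qed (use 1 less.prems in simp_all)
  next
    case 2
    then show ?thesis using less.prems by (auto intro: coprime_bounds_equal)
  next
    case 3
    have box: "set_mset (image_mset uminus S) \<subseteq> {-M..m}" "0 \<notin># image_mset uminus S"
      using less.prems by force+
    have "coprime_bounds M m (image_mset uminus S)"
    proof (rule coprime_bounds_step)
      fix m' T
      assume "0 < m'" "m' \<le> M" "minimal_zero_sum T" "set_mset T \<subseteq> {-m'..m - m'}" "0 \<notin># T"
      then show "coprime_bounds m' (m - m') T" using 3 less.prems by (intro less.hyps) auto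
    qed (use 3 box less.prems minimal_zero_sum_uminus in simp_all)
    then show ?thesis by (rule coprime_bounds_uminus)
  qed
qed

section \<open>Extremal sequences and the formula\<close>

text \<open>A zero-sum subsequence with \<open>a\<close> copies of \<open>x\<close> and
  \<open>b\<close> of \<open>- y\<close> satisfies \<open>a * x = b * y\<close>; coprimality gives
  \<open>y dvd a\<close>, so \<open>a\<close> is \<open>0\<close> or \<open>y\<close>.\<close>

lemma coprime_minimal_zero_sum:
  fixes x y :: nat
  assumes "0 < x" "0 < y" "coprime x y"
  shows "minimal_zero_sum (replicate_mset y (int x) + replicate_mset x (- int y))"
  unfolding minimal_zero_sum_def zero_sum_def
proof (intro conjI allI impI notI)
  show "sum_mset (replicate_mset y (int x) + replicate_mset x (- int y)) = 0"
    by simp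
next
  let ?S = "replicate_mset y (int x) + replicate_mset x (- int y)"
  fix T assume T: "T \<noteq> {#} \<and> T \<subset># ?S" and sum: "sum_mset T = 0"
  define a b where "a = count T (int x)" and "b = count T (- int y)"
  have neq: "int x \<noteq> - int y" using assms by simp
  have le: "count T e \<le> count ?S e" for e
    using T by (intro mset_subset_eq_count subset_mset.less_imp_le) (elim conjE)
  have T_eq: "T = replicate_mset a (int x) + replicate_mset b (- int y)"
  proof (rule multiset_eqI)
    fix e show "count T e = count (replicate_mset a (int x) + replicate_mset b (- int y)) e"
      using le[of e] neq by (auto simp: a_def b_def)
  qed
  have "a \<le> y" "b \<le> x" using le[of "int x"] le[of "- int y"] neq assms by (auto simp: a_def b_def)
  have "int a * int x = int b * int y" using sum unfolding T_eq by simp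
  then have eq: "a * x = b * y" by (metis of_nat_eq_iff of_nat_mult)
  then have "y dvd a" using assms(3) by (metis coprime_commute coprime_dvd_mult_left_iff dvd_triv_right)
  then have "a = 0 \<or> a = y" using \<open>a \<le> y\<close> by (auto dest: dvd_imp_le)
  then show False
  proof
    assume "a = 0"
    then have "b = 0" using eq assms by simp
    then show False using T T_eq \<open>a = 0\<close> by simp
  next
    assume "a = y"
    then have "b = x" using eq assms by simp
    then show False using T T_eq \<open>a = y\<close> by simp
  qed
qed

theorem theorem1p2:
  fixes m M :: int
  assumes "m > 0" and "M > 0"
  shows "int (davenport {-m..M}) = m + M - int (rho m M)"
proof -
  define good where "good t \<longleftrightarrow> (\<exists>t'::nat. t' \<le> t \<and> gcd (M - int t') (m - (int t - int t')) = 1)" for t :: nat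
  have rho: "rho m M = (LEAST t. good t)" by (simp add: rho_def good_def)
  \<comment> \<open>Taking \<open>t' = 0\<close> leaves \<open>gcd M 1\<close>, and
    \<open>t' = t\<close> below leaves \<open>gcd 1 m\<close>. Together the two bounds on
    \<open>rho\<close> keep both arguments of the optimal \<open>gcd\<close> positive.\<close>
  have "good (nat (m - 1))" unfolding good_def
    using assms by (intro exI[of _ 0]) auto
  then have "rho m M \<le> nat (m - 1)" unfolding rho by (rule Least_le)
  then have rho_m: "int (rho m M) \<le> m - 1" using assms by linarith
  have "good (nat (M - 1))" unfolding good_def
    using assms by (intro exI[of _ "nat (M - 1)"]) auto
  then have "rho m M \<le> nat (M - 1)" unfolding rho by (rule Least_le)
  then have rho_M: "int (rho m M) \<le> M - 1" using assms by linarith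
  from \<open>good (nat (M - 1))\<close> have "good (rho m M)" unfolding rho by (rule LeastI)
  then obtain t' where t': "t' \<le> rho m M" "gcd (M - int t') (m - (int (rho m M) - int t')) = 1"
    unfolding good_def by (elim exE conjE)
  let ?L = "minimal_zero_sum_lengths {-m..M}"
  have "Max ?L = nat (m + M - int (rho m M))"
  proof (rule Max_eqI)
    show "finite ?L" using assms by (intro finite_minimal_zero_sum_lengths) auto
  next
    define x y where "x = nat (M - int t')" and "y = nat (m - (int (rho m M) - int t'))"
    have xy: "int x = M - int t'" "int y = m - (int (rho m M) - int t')" "0 < x" "0 < y"
      using t' rho_m rho_M by (auto simp: x_def y_def)
    have "coprime (int x) (int y)"
      unfolding xy(1,2) using t'(2) by (simp add: coprime_iff_gcd_eq_1)
    then have "coprime x y" by simp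
    then have "minimal_zero_sum (replicate_mset y (int x) + replicate_mset x (- int y))"
      using xy by (intro coprime_minimal_zero_sum) auto
    moreover have "nat (m + M - int (rho m M)) = size (replicate_mset y (int x) + replicate_mset x (- int y))"
      using xy by simp
    moreover have "set_mset (replicate_mset y (int x) + replicate_mset x (- int y)) \<subseteq> {-m..M}"
      using xy t' assms by (auto split: if_splits)
    ultimately show "nat (m + M - int (rho m M)) \<in> ?L"
      unfolding minimal_zero_sum_lengths_def by blast
  next
    fix s assume "s \<in> ?L"
    then obtain S where S: "s = size S" "minimal_zero_sum S" "set_mset S \<subseteq> {-m..M}"
      unfolding minimal_zero_sum_lengths_def by blast
    show "s \<le> nat (m + M - int (rho m M))"
    proof (cases "0 \<in># S")
      case True
      \<comment> \<open>A zero is by itself a zero-sum subsequence, so the length is 1.\<close>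
      then have "{#0#} = S" by (intro minimal_zero_sumD[OF S(2)]) auto
      then show ?thesis using S(1) rho_m assms by auto
    next
      case False
      then obtain x y where xy: "coprime x y" "int (low (M - m) S) \<le> x" "x \<le> M"
          "int (low (m - M) (image_mset uminus S)) \<le> y" "y \<le> m"
        using coprime_bounds[OF assms S(2,3)] unfolding coprime_bounds_def by blast
      have "low 0 S \<le> low (M - m) S" "low 0 (image_mset uminus S) \<le> low (m - M) (image_mset uminus S)"
        using False by (auto intro!: low_0_le)
      then have "int (size S) \<le> x + y" using size_eq_low_plus_low[OF False] xy by linarith
      \<comment> \<open>The coprime pair is read as a competitor in \<open>rho\<close> with
        \<open>t' = M - x\<close> and \<open>t - t' = m - y\<close>.\<close>
      moreover have "good (nat (M - x) + nat (m - y))" unfolding good_def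
        using xy by (intro exI[of _ "nat (M - x)"]) (auto simp: coprime_iff_gcd_eq_1)
      then have "rho m M \<le> nat (M - x) + nat (m - y)" unfolding rho by (rule Least_le)
      ultimately show ?thesis using xy S(1) by linarith
    qed
  qed
  then show ?thesis unfolding davenport_def using rho_m assms by simp
qed

end
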